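(* Let $f\in L^2(X,\nu)$ and $\lambda>0$. Then there exists a unique minimizer $u_\lambda$ of the problem $$\min\left\{TV_m(u)+\frac{\lambda}{2}\int_X|u(x)-f(x)|^2\,d\nu(x)\ :\ u\in L^2(X,\nu)\right\}.\qquad (P)$$ Moreover, $u_\lambda$ is the unique solution $u\in L^2(X,\nu)$ of the problem $$\lambda(u-f)\in\Delta_1^m(u).$$ Consequently, $u_\lambda\in L^2(X,\nu)$ is the solution of $(P)$ if, and only if, there exists an antisymmetric $\mathbf g\in L^\infty(X\times X,\nu\otimes m_x)$ with $\|\mathbf g\|_\infty\le 1$ such that $$\lambda(u_\lambda-f)=\mathrm{div}_m\,\mathbf g$$ and $$\mathbf g(x,y)\in\mathrm{sign}(u_\lambda(y)-u_\lambda(x))\quad\text{for }(\nu\otimes m_x)\text{-a.e. }(x,y)\in X\times X.$$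
   Context: Setting: $(X,d)$ is a Polish metric space with its Borel $\sigma$-algebra. A random walk $m=(m_x)_{x\in X}$ on $X$ is a family of Borel probability measures on $X$ such that $x\mapsto m_x(A)$ is Borel for every Borel $A\subset X$ and $\int_X d(z,y)\,dm_x(y)<\infty$ for all $x\in X$ and some (hence any) $z\in X$; $[X,d,m]$ is a metric random walk space. $\nu$ is a finite (nonzero) Radon measure on $X$ which is reversible for $m$: $dm_x(y)d\nu(x)=dm_y(x)d\nu(y)$ as measures on $X\times X$ (this implies invariance, $\nu(A)=\int_X m_x(A)\,d\nu(x)$). It is also assumed that $\frac1{\nu(X)}\nu$ is ergodic with respect to $m$: every Borel set $B$ with $m_x(B)=1$ for all $x\in B$ satisfies $\nu(B)=0$ or $\nu(B)=\nu(X)$. $\nu\otimes m_x$ is the measure on $X\times X$ given by $\nu\otimes m_x(U)=\int_X\int_X\chi_U(x,y)\,dm_x(y)\,d\nu(x)$. $m$-total variation: $TV_m(u)=\frac12\int_X\int_X|u(y)-u(x)|\,dm_x(y)\,d\nu(x)$ (finite for $u\in L^1(X,\nu)$). $\mathcal F_m:L^2(X,\nu)\to\,]-\infty,+\infty]$ is the convex, lower semicontinuous functional $\mathcal F_m(u)=TV_m(u)$, and $\partial\mathcal F_m$ is its subdifferential in $L^2(X,\nu)$. The multivalued operator $\Delta_1^m$ in $L^2(X,\nu)$ is defined by: $v\in\Delta_1^m(u)$ iff $-v\in\partial\mathcal F_m(u)$. $m$-divergence of $\mathbf z:X\times X\to\mathbb R$: $(\mathrm{div}_m\mathbf z)(x)=\frac12\int_X(\mathbf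 z(x,y)-\mathbf z(y,x))\,dm_x(y)$. $\mathbf g$ antisymmetric means $\mathbf g(x,y)=-\mathbf g(y,x)$. $\mathrm{sign}$ is the multivalued sign: $\mathrm{sign}(r)=\{1\}$ if $r>0$, $\{-1\}$ if $r<0$, $[-1,1]$ if $r=0$. *)

theory Defs
  imports "HOL-Probability.Probability"
begin

definition random_walk :: "('a::polish_space \<Rightarrow> 'a measure) \<Rightarrow> bool" where
  "random_walk m \<longleftrightarrow>
     (\<forall>x. prob_space (m x) \<and> sets (m x) = sets borel) \<and>
     (\<forall>A\<in>sets borel. (\<lambda>x. emeasure (m x) A) \<in> borel_measurable borel) \<and>
     (\<exists>z. \<forall>x. (\<integral>\<^sup>+ y. ennreal (dist z y) \<partial>m x) < \<infinity>)"

(* dm_x(y) dnu(x); since the space is second countable, the product sigma-algebra used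
   here is the Borel sigma-algebra of X * X. *)
definition kernel_prod ::
    "'a::polish_space measure \<Rightarrow> ('a \<Rightarrow> 'a measure) \<Rightarrow> ('a \<times> 'a) measure" where
  "kernel_prod nu m = measure_of UNIV (sets (borel \<Otimes>\<^sub>M borel))
     (\<lambda>U. \<integral>\<^sup>+ x. (\<integral>\<^sup>+ y. indicator U (x, y) \<partial>m x) \<partial>nu)"

(* dm_y(x) dnu(y) is the image of dm_x(y) dnu(x) under the exchange of coordinates. *)
definition reversible ::
    "'a::polish_space measure \<Rightarrow> ('a \<Rightarrow> 'a measure) \<Rightarrow> bool" where
  "reversible nu m \<longleftrightarrow>
     distr (kernel_prod nu m) (borel \<Otimes>\<^sub>M borel) prod.swap = kernel_prod nu m"

(* Ergodicity of nu / nu(X), written without normalising nu. *)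
definition ergodic ::
    "'a::polish_space measure \<Rightarrow> ('a \<Rightarrow> 'a measure) \<Rightarrow> bool" where
  "ergodic nu m \<longleftrightarrow>
     (\<forall>B\<in>sets borel. (\<forall>x\<in>B. emeasure (m x) B = 1) \<longrightarrow>
        emeasure nu B = 0 \<or> emeasure nu B = emeasure nu UNIV)"

(* L2 and Linf are spaces of representatives: elements are functions, and equality of
   elements of the corresponding Lebesgue space is equality almost everywhere. *)
definition L2 :: "'a measure \<Rightarrow> ('a \<Rightarrow> real) set" where
  "L2 M = {u \<in> borel_measurable M. integrable M (\<lambda>x. (u x)\<^sup>2)}"

definition Linf_norm :: "'a measure \<Rightarrow> ('a \<Rightarrow> real) \<Rightarrow> ereal" where
  "Linf_norm M g = esssup M (\<lambda>x. ereal \<bar>g x\<bar>)"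

definition Linf :: "'a measure \<Rightarrow> ('a \<Rightarrow> real) set" where
  "Linf M = {g \<in> borel_measurable M. Linf_norm M g < \<infinity>}"

definition TV ::
    "'a::polish_space measure \<Rightarrow> ('a \<Rightarrow> 'a measure) \<Rightarrow> ('a \<Rightarrow> real) \<Rightarrow> ennreal" where
  "TV nu m u = ennreal (1/2) * (\<integral>\<^sup>+ x. (\<integral>\<^sup>+ y. ennreal \<bar>u y - u x\<bar> \<partial>m x) \<partial>nu)"

definition TV_functional ::
    "'a::polish_space measure \<Rightarrow> ('a \<Rightarrow> 'a measure) \<Rightarrow> ('a \<Rightarrow> real) \<Rightarrow> ereal" where
  "TV_functional nu m u = enn2ereal (TV nu m u)"

definition L2_subdifferential ::
    "'a measure \<Rightarrow> (('a \<Rightarrow> real) \<Rightarrow> ereal) \<Rightarrow> ('a \<Rightarrow> real) \<Rightarrow> ('a \<Rightarrow> real) set" where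
  "L2_subdifferential M F u =
     {v \<in> L2 M. u \<in> L2 M \<and> F u < \<infinity> \<and>
        (\<forall>w\<in>L2 M. F w \<ge> F u + ereal (\<integral>x. v x * (w x - u x) \<partial>M))}"

definition one_laplacian ::
    "'a::polish_space measure \<Rightarrow> ('a \<Rightarrow> 'a measure) \<Rightarrow> ('a \<Rightarrow> real) \<Rightarrow> ('a \<Rightarrow> real) set" where
  "one_laplacian nu m u =
     {v. (\<lambda>x. - v x) \<in> L2_subdifferential nu (TV_functional nu m) u}"

definition m_div :: "('a::polish_space \<Rightarrow> 'a measure) \<Rightarrow> ('a \<times> 'a \<Rightarrow> real) \<Rightarrow> 'a \<Rightarrow> real" where
  "m_div m z x = 1/2 * (\<integral>y. z (x, y) - z (y, x) \<partial>m x)"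

(* For an element of an L-infinity space on X * X, hence almost everywhere. A function that
   is antisymmetric in this sense agrees almost everywhere with the pointwise antisymmetric
   function (g (x, y) - g (y, x)) / 2. *)
definition antisymmetric :: "('a \<times> 'a) measure \<Rightarrow> ('a \<times> 'a \<Rightarrow> real) \<Rightarrow> bool" where
  "antisymmetric M g \<longleftrightarrow> (AE (x, y) in M. g (x, y) = - g (y, x))"

definition msign :: "real \<Rightarrow> real set" where
  "msign r = (if r > 0 then {1} else if r < 0 then {-1} else {-1..1})"

definition ROF_energy ::
    "'a::polish_space measure \<Rightarrow> ('a \<Rightarrow> 'a measure) \<Rightarrow> real \<Rightarrow> ('a \<Rightarrow> real) \<Rightarrow>
     ('a \<Rightarrow> real) \<Rightarrow> ennreal" where
  "ROF_energy nu m lam f u =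
     TV nu m u + ennreal (lam/2) * (\<integral>\<^sup>+ x. ennreal (\<bar>u x - f x\<bar>\<^sup>2) \<partial>nu)"

definition ROF_minimizer ::
    "'a::polish_space measure \<Rightarrow> ('a \<Rightarrow> 'a measure) \<Rightarrow> real \<Rightarrow> ('a \<Rightarrow> real) \<Rightarrow>
     ('a \<Rightarrow> real) \<Rightarrow> bool" where
  "ROF_minimizer nu m lam f u \<longleftrightarrow>
     u \<in> L2 nu \<and> (\<forall>w\<in>L2 nu. ROF_energy nu m lam f u \<le> ROF_energy nu m lam f w)"

end

theory Submission
  imports Defs
begin

text \<open>
  The proof goes through the dual problem. Let \<open>K\<close> be the measure \<open>dm_x(y) d\<nu>(x)\<close>, which
  reversibility makes symmetric, and call a \<^emph>\<open>flow\<close> an antisymmetric \<open>g\<close> with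
  \<open>\<bar>g\<bar> \<le> 1\<close>. Integration by parts gives \<open>- \<integral>u div g d\<nu> = 1/2 \<integral>g(x,y)(u(y) - u(x)) dK\<close>, so
  this number is at most the total variation of \<open>u\<close>, and it equals the total variation
  precisely when \<open>g(x,y) \<in> sign(u(y) - u(x))\<close> almost everywhere
  (\<open>minus_integral_m_div_le_tv\<close>, \<open>minus_integral_m_div_eq_tv_iff\<close>). Flows thus
  stand for subgradients of the total variation: if \<open>g\<close> attains the bound at \<open>u\<close>, then
  \<open>div g \<in> \<Delta>\<^sub>1(u)\<close> (\<open>flow_imp_one_laplacian\<close>).

  A pair \<open>(u, g)\<close> as in the characterisation is found by minimising
  \<open>\<integral>(\<lambda>f + div g)\<^sup>2 d\<nu>\<close> over all flows and setting \<open>u = f + div g / \<lambda>\<close>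
  (\<open>solution_exists\<close>). Minimality of \<open>g\<close> says \<open>\<integral>u div g d\<nu> \<le> \<integral>u div h d\<nu>\<close> for every flow \<open>h\<close>;
  with \<open>h(x,y) = sgn(u(y) - u(x))\<close> the right-hand side is minus the total variation of \<open>u\<close>, so
  \<open>g\<close> attains the bound at \<open>u\<close>. A dual minimiser exists because the flows form a bounded closed
  convex subset of \<open>L\<^sup>2(K)\<close>. No weak topology is involved: near-minimal elements of almost
  minimal norm form, by the parallelogram identity, a Cauchy sequence
  (\<open>nested_midpoint_convex_AE_convergent\<close>).

  Conversely, a solution \<open>u\<close> of the inclusion \<open>\<lambda>(u - f) \<in> \<Delta>\<^sub>1(u)\<close> beats every competitor \<open>w\<close> by at least
  \<open>\<lambda>/2 \<parallel>w - u\<parallel>\<^sup>2\<close> (\<open>one_laplacian_energy_gap\<close>). As a solution has already been constructed, this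
  shows that it is the only minimiser and the only solution of the inclusion, and that every
  minimiser inherits its flow.
\<close>

section \<open>Nested convex sets of bounded functions\<close>

text \<open>
  The argument is the one by which a decreasing sequence of nonempty bounded closed convex sets in a
  Hilbert space is seen to have a common point. Let \<open>r n\<close> be the infimum of the squared
  norm on \<open>S n\<close> and let \<open>r\<close> increase to \<open>L\<close>. An element of \<open>S k\<close> with squared norm below
  \<open>L + \<epsilon>\<close> and a later one of the same kind have a midpoint in \<open>S k\<close>, of squared norm at least
  \<open>L - \<epsilon>\<close> for large \<open>k\<close>, so the parallelogram identity bounds their squared distance by \<open>8\<epsilon>\<close>.
  With \<open>\<epsilon> = 1/4^n\<close> the consecutive distances are summable, hence there is almost everywhere
  convergence along the whole sequence.
\<close>

lemma nested_midpoint_convex_AE_convergent: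
  fixes S :: "nat \<Rightarrow> ('b \<Rightarrow> real) set"
  assumes fin: "finite_measure M"
    and ne: "\<And>n. S n \<noteq> {}" and dec: "decseq S"
    and meas: "\<And>g. g \<in> S 0 \<Longrightarrow> g \<in> borel_measurable M"
    and bd: "\<And>g x. g \<in> S 0 \<Longrightarrow> \<bar>g x\<bar> \<le> B"
    and mid: "\<And>n g h. g \<in> S n \<Longrightarrow> h \<in> S n \<Longrightarrow> (\<lambda>x. (g x + h x) / 2) \<in> S n"
  shows "\<exists>p. (\<forall>n. p n \<in> S n) \<and> (AE x in M. convergent (\<lambda>n. p n x))"
proof -
  interpret finite_measure M by fact
  define N where "N g = (\<integral>x. (g x)\<^sup>2 \<partial>M)" for g :: "'b \<Rightarrow> real"
  define r where "r n = Inf (N ` S n)" for n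
  have sub: "S n \<subseteq> S k" if "k \<le> n" for k n
    using decseqD[OF dec that] .
  have S_meas: "g \<in> borel_measurable M" if "g \<in> S n" for g n
    using sub[of 0 n] that meas by blast
  have S_bd: "\<bar>g x\<bar> \<le> B" if "g \<in> S n" for g n x
    using sub[of 0 n] that bd by blast
  have S_sq: "(g x)\<^sup>2 \<le> B\<^sup>2" if "g \<in> S n" for g n x
    using power_mono[OF S_bd[OF that, of x], of 2] by simp
  have S_int: "integrable M (\<lambda>x. (g x)\<^sup>2)" if "g \<in> S n" for g n
    by (rule integrable_const_bound[where B = "B\<^sup>2"]) (use S_sq S_meas that in auto)
  have N_nonneg: "0 \<le> N g" for g
    by (simp add: N_def)
  have bdd: "bdd_below (N ` S n)" for n
    using N_nonneg by (auto intro!: bdd_belowI[of _ 0])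
  have r_le: "r n \<le> N g" if "g \<in> S n" for n g
    unfolding r_def using that bdd by (auto intro: cInf_lower)
  have r_mono: "incseq r"
    unfolding r_def incseq_def
    by (auto intro!: cInf_superset_mono bdd image_mono sub simp: ne)
  have "r n \<le> B\<^sup>2 * measure M (space M)" for n
  proof -
    obtain g where g: "g \<in> S n" using ne by blast
    have "N g \<le> (\<integral>x. B\<^sup>2 \<partial>M)"
      unfolding N_def using S_int[OF g] S_sq[OF g] by (intro integral_mono) auto
    with r_le[OF g] show ?thesis by (simp add: mult.commute)
  qed
  then obtain L where L: "r \<longlonglongrightarrow> L" and r_le_L: "\<And>n. r n \<le> L"
    using incseq_convergent[OF r_mono] by metis
  have "\<exists>j. L - 1 / 4 ^ n \<le> r j" for n
  proof -
    have "eventually (\<lambda>j. L - 1 / 4 ^ n < r j) sequentially"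
      using L by (rule order_tendstoD) simp
    then show ?thesis by (auto simp: eventually_sequentially intro: less_imp_le)
  qed
  then obtain K where K: "\<And>n. L - 1 / 4 ^ n \<le> r (K n)" by metis
  \<comment> \<open>A sum, so that the indices are monotone and dominate both \<open>n\<close> and \<open>K n\<close>.\<close>
  define k where "k n = n + (\<Sum>i\<le>n. K i)" for n
  have k_ge: "n \<le> k n" and k_K: "K n \<le> k n" and k_Suc: "k n \<le> k (Suc n)" for n
    by (auto simp: k_def intro!: trans_le_add2 member_le_sum)
  have r_k: "L - 1 / 4 ^ n \<le> r (k n)" for n
    using K[of n] incseqD[OF r_mono k_K[of n]] by linarith
  have "\<exists>g. g \<in> S (k n) \<and> N g < L + 1 / 4 ^ n" for n
  proof -
    have "Inf (N ` S (k n)) < L + 1 / 4 ^ n"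
      using r_le_L[of "k n"] by (auto simp: r_def intro: le_less_trans)
    then show ?thesis using ne cInf_lessD[of "N ` S (k n)"] by blast
  qed
  then obtain p where p: "\<And>n. p n \<in> S (k n)" and pN: "\<And>n. N (p n) < L + 1 / 4 ^ n"
    by metis
  have p_meas[measurable]: "p n \<in> borel_measurable M" for n using p S_meas by blast
  define d where "d n x = \<bar>p n x - p (Suc n) x\<bar>" for n x
  have d_meas[measurable]: "d n \<in> borel_measurable M" for n unfolding d_def by simp
  have d_nonneg: "0 \<le> d n x" for n x unfolding d_def by simp
  have d_bd: "d n x \<le> 2 * B" for n x
    unfolding d_def using S_bd[OF p[of n], of x] S_bd[OF p[of "Suc n"], of x] by linarith
  have d_sq_bd: "(d n x)\<^sup>2 \<le> (2 * B)\<^sup>2" for n x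
    by (rule power_mono[OF d_bd]) (simp add: d_def)
  have d_int: "integrable M (d n)" for n
    by (rule integrable_const_bound[where B = "2 * B"]) (use d_bd in \<open>auto simp: d_def\<close>)
  have d_sq_int: "integrable M (\<lambda>x. (d n x)\<^sup>2)" for n
    by (rule integrable_const_bound[where B = "(2 * B)\<^sup>2"]) (use d_sq_bd in auto)
  have d_sq: "(\<integral>x. (d n x)\<^sup>2 \<partial>M) \<le> 8 / 4 ^ n" for n
  proof -
    let ?h = "\<lambda>x. (p n x + p (Suc n) x) / 2"
    have pS: "p (Suc n) \<in> S (k n)" using p[of "Suc n"] sub[OF k_Suc] by blast
    have h: "?h \<in> S (k n)" by (rule mid[OF p pS])
    have "(\<integral>x. (d n x)\<^sup>2 \<partial>M) = (\<integral>x. 2 * (p n x)\<^sup>2 + 2 * (p (Suc n) x)\<^sup>2 - 4 * (?h x)\<^sup>2 \<partial>M)"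
      by (rule Bochner_Integration.integral_cong) (auto simp: d_def power2_eq_square field_simps)
    also have "\<dots> = 2 * N (p n) + 2 * N (p (Suc n)) - 4 * N ?h"
      unfolding N_def using S_int[OF p[of n]] S_int[OF pS] S_int[OF h] by simp
    also have "\<dots> \<le> 2 * (L + 1 / 4 ^ n) + 2 * (L + 1 / 4 ^ n) - 4 * (L - 1 / 4 ^ n)"
    proof -
      define q where "q = (1::real) / 4 ^ n"
      have "(1::real) / 4 ^ Suc n \<le> q" by (simp add: q_def field_simps)
      with pN[of "Suc n"] have "N (p (Suc n)) < L + q" by linarith
      moreover have "N (p n) < L + q" "L - q \<le> N ?h"
        using pN[of n] r_le[OF h] r_k[of n] by (auto simp: q_def)
      moreover have "2 * a + 2 * b - 4 * c \<le> 2 * (L + q) + 2 * (L + q) - 4 * (L - q)"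
        if "a < L + q" "b < L + q" "L - q \<le> c" for a b c :: real
        using that by (simp add: algebra_simps)
      ultimately show ?thesis unfolding q_def by blast
    qed
    finally show ?thesis by simp
  qed
  have d_le: "(\<integral>x. d n x \<partial>M) \<le> (measure M (space M) + 8) * (1/2) ^ n" for n
  proof -
    \<comment> \<open>Weighted so that the quadratic bound \<open>8 / 4 ^ n\<close> becomes geometric again after multiplication by \<open>2 ^ n\<close>.\<close>
    have "d n x \<le> (1/2) ^ n + 2 ^ n * (d n x)\<^sup>2" for x
    proof -
      have "0 \<le> d n x" by (simp add: d_def)
      have "1 * d n x \<le> 1 / 2 ^ n + 2 ^ n * (d n x)\<^sup>2"
      proof (cases "d n x \<le> 1 / 2 ^ n")
        case False
        then have "1 \<le> 2 ^ n * d n x" by (simp add: field_simps)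
        then have "1 * d n x \<le> (2 ^ n * d n x) * d n x"
          by (rule mult_right_mono) fact
        then show ?thesis
          unfolding power2_eq_square by (intro add_increasing) (simp_all add: mult.assoc)
      qed (simp add: add_increasing2)
      then show ?thesis by (simp add: power_one_over)
    qed
    then have "(\<integral>x. d n x \<partial>M) \<le> (\<integral>x. (1/2) ^ n + 2 ^ n * (d n x)\<^sup>2 \<partial>M)"
      using d_int d_sq_int by (intro integral_mono) auto
    also have "\<dots> = measure M (space M) * (1/2) ^ n + 2 ^ n * (\<integral>x. (d n x)\<^sup>2 \<partial>M)"
      using d_sq_int by simp
    also have "\<dots> \<le> measure M (space M) * (1/2) ^ n + 2 ^ n * (8 / 4 ^ n)"
      by (intro add_left_mono mult_left_mono d_sq) simp
    also have "2 ^ n * (8 / 4 ^ n) = 8 * (1/2 :: real) ^ n"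
      by (simp add: field_simps flip: power_mult_distrib)
    finally show ?thesis by (simp add: field_simps)
  qed
  have "AE x in M. summable (\<lambda>n. d n x)"
  proof -
    have "(\<integral>\<^sup>+x. (\<Sum>n. ennreal (d n x)) \<partial>M) = (\<Sum>n. \<integral>\<^sup>+x. ennreal (d n x) \<partial>M)"
      by (rule nn_integral_suminf) simp
    also have "\<dots> = (\<Sum>n. ennreal (\<integral>x. d n x \<partial>M))"
      using d_int by (intro suminf_cong nn_integral_eq_integral) (auto intro!: AE_I2 d_nonneg)
    also have "\<dots> \<le> (\<Sum>n. ennreal ((measure M (space M) + 8) * (1/2) ^ n))"
      by (intro suminf_le ennreal_leI d_le) auto
    also have "\<dots> = ennreal (\<Sum>n. (measure M (space M) + 8) * (1/2) ^ n)"
      by (intro suminf_ennreal2 summable_mult summable_geometric) auto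
    also have "\<dots> < \<infinity>" by simp
    finally have "AE x in M. (\<Sum>n. ennreal (d n x)) \<noteq> \<infinity>"
      by (intro nn_integral_PInf_AE) auto
    then show ?thesis
      by eventually_elim (auto intro!: summable_suminf_not_top simp: d_def)
  qed
  then have "AE x in M. convergent (\<lambda>n. p n x)"
  proof eventually_elim
    case (elim x)
    have "summable (\<lambda>n. p (Suc n) x - p n x)"
      by (rule summable_rabs_cancel) (use elim in \<open>simp add: d_def abs_minus_commute\<close>)
    then have "convergent (\<lambda>n. \<Sum>i<n. p (Suc i) x - p i x)"
      by (simp add: summable_iff_convergent)
    then have "convergent (\<lambda>n. (\<Sum>i<n. p (Suc i) x - p i x) + p 0 x)"
      by (intro convergent_add convergent_const)
    then show ?case by (simp add: sum_lessThan_telescope[of "\<lambda>i. p i x"])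
  qed
  moreover have "p n \<in> S n" for n using p[of n] sub[OF k_ge[of n]] by blast
  ultimately show ?thesis by blast
qed

section \<open>Square-integrable functions\<close>

lemma L2_iff: "u \<in> L2 M \<longleftrightarrow> u \<in> borel_measurable M \<and> integrable M (\<lambda>x. (u x)\<^sup>2)"
  by (simp add: L2_def)

lemma integrable_L2_mult:
  assumes "u \<in> L2 M" "v \<in> L2 M"
  shows "integrable M (\<lambda>x. u x * v x)"
proof (rule Bochner_Integration.integrable_bound)
  show "integrable M (\<lambda>x. (u x)\<^sup>2 + (v x)\<^sup>2)"
    using assms by (simp add: L2_iff)
  have "\<bar>a * b\<bar> \<le> a\<^sup>2 + b\<^sup>2" for a b :: real
  proof -
    have "2 * \<bar>a * b\<bar> \<le> a\<^sup>2 + b\<^sup>2"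
      using sum_squares_bound[of "\<bar>a\<bar>" "\<bar>b\<bar>"] by (simp add: abs_mult mult.assoc)
    then show ?thesis using abs_ge_zero[of "a * b"] by linarith
  qed
  then show "AE x in M. norm (u x * v x) \<le> norm ((u x)\<^sup>2 + (v x)\<^sup>2)"
    by (auto intro!: AE_I2)
qed (use assms in \<open>auto simp: L2_iff\<close>)

lemma L2_lincomb:
  assumes "u \<in> L2 M" "v \<in> L2 M"
  shows "(\<lambda>x. a * u x + b * v x) \<in> L2 M"
proof -
  have "(\<lambda>x. (a * u x + b * v x)\<^sup>2)
      = (\<lambda>x. a\<^sup>2 * (u x)\<^sup>2 + b\<^sup>2 * (v x)\<^sup>2 + 2 * a * b * (u x * v x))"
    by (auto simp: power2_eq_square algebra_simps)
  moreover have "integrable M (\<lambda>x. a\<^sup>2 * (u x)\<^sup>2 + b\<^sup>2 * (v x)\<^sup>2 + 2 * a * b * (u x * v x))"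
    using integrable_L2_mult[OF assms] assms by (auto simp: L2_iff)
  moreover have "(\<lambda>x. a * u x + b * v x) \<in> borel_measurable M"
    using assms by (auto simp: L2_iff)
  ultimately show ?thesis
    by (simp add: L2_iff)
qed

lemma L2_diff: "u \<in> L2 M \<Longrightarrow> v \<in> L2 M \<Longrightarrow> (\<lambda>x. u x - v x) \<in> L2 M"
  using L2_lincomb[of u M v 1 "-1"] by simp

lemma L2_cmult: "u \<in> L2 M \<Longrightarrow> (\<lambda>x. c * u x) \<in> L2 M"
  using L2_lincomb[of u M u c 0] by simp

lemma (in finite_measure) L2_integrable: "u \<in> L2 M \<Longrightarrow> integrable M u"
  by (simp add: L2_iff square_integrable_imp_integrable)

lemma (in finite_measure) bounded_L2:
  assumes "u \<in> borel_measurable M" "\<And>x. \<bar>u x\<bar> \<le> B"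
  shows "u \<in> L2 M"
proof -
  have "(u x)\<^sup>2 \<le> B\<^sup>2" for x
    using power_mono[OF assms(2)[of x], of 2] by simp
  then show ?thesis
    using assms(1) by (auto simp: L2_iff intro!: integrable_const_bound[where B = "B\<^sup>2"])
qed

section \<open>Flows and the multivalued sign\<close>

text \<open>
  Bound and antisymmetry are imposed at every point, so that the slice at every single \<open>x\<close> is
  integrable and linearity of the divergence holds without exceptional sets.
\<close>

definition flows :: "('a::topological_space \<times> 'a \<Rightarrow> real) set" where
  "flows = {g \<in> borel_measurable (borel \<Otimes>\<^sub>M borel).
     \<forall>x y. \<bar>g (x, y)\<bar> \<le> 1 \<and> g (y, x) = - g (x, y)}"

lemma flowsD:
  assumes "g \<in> flows"
  shows "g \<in> borel_measurable (borel \<Otimes>\<^sub>M borel)" "\<bar>g p\<bar> \<le> 1" "g (y, x) = - g (x, y)"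
proof -
  have "\<bar>g (fst p, snd p)\<bar> \<le> 1" "g (y, x) = - g (x, y)"
    "g \<in> borel_measurable (borel \<Otimes>\<^sub>M borel)"
    using assms unfolding flows_def by blast+
  then show "g \<in> borel_measurable (borel \<Otimes>\<^sub>M borel)" "\<bar>g p\<bar> \<le> 1" "g (y, x) = - g (x, y)"
    by simp_all
qed

lemma flows_convex:
  assumes "g \<in> flows" "h \<in> flows" "0 \<le> t" "t \<le> 1"
  shows "(\<lambda>p. (1 - t) * g p + t * h p) \<in> flows"
proof -
  have "\<bar>(1 - t) * g p + t * h p\<bar> \<le> 1" for p
  proof -
    have "\<bar>(1 - t) * g p + t * h p\<bar> \<le> (1 - t) * \<bar>g p\<bar> + t * \<bar>h p\<bar>"
      using assms(3,4) abs_triangle_ineq[of "(1 - t) * g p" "t * h p"] by (simp add: abs_mult)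
    also have "\<dots> \<le> 1"
      using assms(3,4) flowsD(2)[OF assms(1), of p] flowsD(2)[OF assms(2), of p]
      by (intro convex_bound_le) auto
    finally show ?thesis .
  qed
  moreover have "(1 - t) * g (y, x) + t * h (y, x) = - ((1 - t) * g (x, y) + t * h (x, y))" for x y
    using flowsD(3)[OF assms(1), of y x] flowsD(3)[OF assms(2), of y x] by (simp add: algebra_simps)
  moreover have "(\<lambda>p. (1 - t) * g p + t * h p) \<in> borel_measurable (borel \<Otimes>\<^sub>M borel)"
    using flowsD(1)[OF assms(1)] flowsD(1)[OF assms(2)] by simp
  ultimately show ?thesis
    unfolding flows_def by blast
qed

text \<open>
  Membership in the multivalued sign is the equality case of \<open>s d \<le> \<bar>d\<bar>\<close>; this is what turns an
  equality of integrals into a pointwise sign condition.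
\<close>

lemma msign_iff:
  assumes "\<bar>s\<bar> \<le> 1" shows "s \<in> msign d \<longleftrightarrow> s * d = \<bar>d\<bar>"
proof -
  consider "d > 0" | "d < 0" | "d = 0" by linarith
  then show ?thesis
  proof cases
    case 2
    then have "s * d = \<bar>d\<bar> \<longleftrightarrow> s * d = (-1) * d" by simp
    also have "\<dots> \<longleftrightarrow> s = -1" using 2 by (subst mult_cancel_right) simp
    finally show ?thesis using 2 by (simp add: msign_def)
  next
    case 3
    then show ?thesis using assms by (simp add: msign_def abs_le_iff)
  qed (simp add: msign_def)
qed

lemma mult_le_abs:
  fixes s d :: real
  assumes "\<bar>s\<bar> \<le> 1" shows "s * d \<le> \<bar>d\<bar>"
proof -
  have "s * d \<le> \<bar>s\<bar> * \<bar>d\<bar>" by (simp flip: abs_mult)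
  also have "\<dots> \<le> \<bar>d\<bar>" using assms by (intro mult_left_le_one_le) auto
  finally show ?thesis .
qed

section \<open>The symmetric measure of a reversible walk\<close>

locale reversible_walk =
  fixes m :: "'a::polish_space \<Rightarrow> 'a measure" and nu :: "'a measure"
  assumes walk: "random_walk m"
    and sets_nu[measurable_cong, simp]: "sets nu = sets borel"
    and finite_nu: "finite_measure nu"
    and reversible: "reversible nu m"
begin

sublocale nu: finite_measure nu
  by (rule finite_nu)

sublocale m: prob_space "m x" for x
  using walk by (simp add: random_walk_def)

abbreviation K :: "('a \<times> 'a) measure" where
  "K \<equiv> kernel_prod nu m"

lemma space_nu[simp]: "space nu = UNIV"
  using sets_eq_imp_space_eq[OF sets_nu] by simp

lemma sets_m[measurable_cong, simp]: "sets (m x) = sets borel"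
  using walk by (simp add: random_walk_def)

lemma space_m[simp]: "space (m x) = UNIV"
  using sets_eq_imp_space_eq[OF sets_m] by simp

lemma m_measurable[measurable]: "m \<in> borel \<rightarrow>\<^sub>M subprob_algebra borel"
  using walk m.subprob_space_axioms
  by (intro measurable_subprob_algebra) (auto simp: random_walk_def)

lemma Pair_kernel_measurable[measurable]:
  "(\<lambda>x. distr (m x) (borel \<Otimes>\<^sub>M borel) (Pair x)) \<in> borel \<rightarrow>\<^sub>M subprob_algebra (borel \<Otimes>\<^sub>M borel)"
  by (intro measurable_distr2) measurable

text \<open>
  The definition by \<open>measure_of\<close> says nothing about the values of the measure until countable
  additivity is known. Writing it as a bind in the Giry monad settles that and makes the rules for
  integrals and null sets of a bind available.
\<close>

lemma kernel_prod_eq_bind: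
  "K = nu \<bind> (\<lambda>x. distr (m x) (borel \<Otimes>\<^sub>M borel) (Pair x))" (is "_ = ?B")
proof -
  have kernel: "(\<lambda>x. distr (m x) (borel \<Otimes>\<^sub>M borel) (Pair x)) \<in> nu \<rightarrow>\<^sub>M subprob_algebra (borel \<Otimes>\<^sub>M borel)"
    by measurable
  have sets_B: "sets ?B = sets (borel \<Otimes>\<^sub>M borel)"
    by (rule sets_bind_measurable[OF kernel]) simp
  then have space_B: "space ?B = UNIV"
    by (auto dest: sets_eq_imp_space_eq simp: space_pair_measure)
  have "(\<integral>\<^sup>+ x. (\<integral>\<^sup>+ y. indicator U (x, y) \<partial>m x) \<partial>nu) = emeasure ?B U"
    if [measurable]: "U \<in> sets (borel \<Otimes>\<^sub>M borel)" for U
  proof -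
    have "emeasure ?B U = (\<integral>\<^sup>+ p. indicator U p \<partial>?B)"
      using that by (simp add: sets_B)
    also have "\<dots> = (\<integral>\<^sup>+ x. (\<integral>\<^sup>+ p. indicator U p \<partial>distr (m x) (borel \<Otimes>\<^sub>M borel) (Pair x)) \<partial>nu)"
      by (rule nn_integral_bind[OF _ kernel]) measurable
    also have "\<dots> = (\<integral>\<^sup>+ x. (\<integral>\<^sup>+ y. indicator U (x, y) \<partial>m x) \<partial>nu)"
      by (intro nn_integral_cong nn_integral_distr) measurable
    finally show ?thesis by simp
  qed
  then have "K = measure_of UNIV (sets (borel \<Otimes>\<^sub>M borel)) (emeasure ?B)"
    unfolding kernel_prod_def
    by (intro measure_of_eq)
      (auto simp: space_pair_measure sets.sigma_sets_eq[of "borel \<Otimes>\<^sub>M borel", unfolded space_pair_measure space_borel UNIV_Times_UNIV])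
  also have "\<dots> = ?B"
    using measure_of_of_measure[of ?B] by (simp only: sets_B space_B)
  finally show ?thesis .
qed

lemma sets_K[measurable_cong, simp]: "sets K = sets (borel \<Otimes>\<^sub>M borel)"
  unfolding kernel_prod_eq_bind by (rule sets_bind_measurable[where B = "borel \<Otimes>\<^sub>M borel"]) simp_all

lemma space_K[simp]: "space K = UNIV"
  using sets_eq_imp_space_eq[OF sets_K] by (simp add: space_pair_measure)

lemma nn_integral_K:
  assumes [measurable]: "h \<in> borel_measurable (borel \<Otimes>\<^sub>M borel)"
  shows "(\<integral>\<^sup>+ p. h p \<partial>K) = (\<integral>\<^sup>+ x. (\<integral>\<^sup>+ y. h (x, y) \<partial>m x) \<partial>nu)"
proof -
  have "(\<integral>\<^sup>+ p. h p \<partial>K) = (\<integral>\<^sup>+ x. (\<integral>\<^sup>+ p. h p \<partial>distr (m x) (borel \<Otimes>\<^sub>M borel) (Pair x)) \<partial>nu)"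
    unfolding kernel_prod_eq_bind by (rule nn_integral_bind) measurable
  also have "\<dots> = (\<integral>\<^sup>+ x. (\<integral>\<^sup>+ y. h (x, y) \<partial>m x) \<partial>nu)"
    by (intro nn_integral_cong nn_integral_distr) measurable
  finally show ?thesis .
qed

lemma AE_K_slices:
  assumes "AE p in K. P p"
  shows "AE x in nu. AE y in m x. P (x, y)"
proof -
  from assms obtain N where N: "{p \<in> space K. \<not> P p} \<subseteq> N" "N \<in> null_sets K"
    by (auto elim: AE_E simp: null_sets_def)
  from N(2) have [measurable]: "N \<in> sets (borel \<Otimes>\<^sub>M borel)"
    by (auto simp: null_sets_def)
  have "(AE p in K. p \<notin> N) \<longleftrightarrow> (AE x in nu. AE p in distr (m x) (borel \<Otimes>\<^sub>M borel) (Pair x). p \<notin> N)"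
    unfolding kernel_prod_eq_bind by (rule AE_bind) measurable
  moreover have "AE p in K. p \<notin> N" using N(2) by (rule AE_not_in)
  ultimately have "AE x in nu. AE p in distr (m x) (borel \<Otimes>\<^sub>M borel) (Pair x). p \<notin> N"
    by simp
  then have "AE x in nu. AE y in m x. (x, y) \<notin> N"
    by (subst (asm) AE_distr_iff) measurable
  then show ?thesis
    using N(1) by (auto elim!: eventually_mono)
qed

text \<open>
  Since every \<open>m x\<close> is a probability measure, \<open>K\<close> has first marginal \<open>nu\<close>; by symmetry the
  second marginal is \<open>nu\<close> too, which is the invariance of \<open>nu\<close>. Hence \<open>nu\<close>-null sets may be
  ignored in either variable, and \<open>u(y) - u(x)\<close> is integrable whenever \<open>u\<close> is.
\<close>

lemma distr_fst: "distr K nu fst = nu"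
proof (rule measure_eqI)
  fix A assume "A \<in> sets (distr K nu fst)"
  then have A[measurable]: "A \<in> sets borel" by simp
  have "emeasure (distr K nu fst) A = (\<integral>\<^sup>+ p. indicator A (fst p) \<partial>K)"
  proof -
    have "emeasure (distr K nu fst) A = (\<integral>\<^sup>+ x. indicator A x \<partial>distr K nu fst)"
      using A by simp
    also have "\<dots> = (\<integral>\<^sup>+ p. indicator A (fst p) \<partial>K)"
      by (rule nn_integral_distr) measurable
    finally show ?thesis .
  qed
  also have "\<dots> = (\<integral>\<^sup>+ x. indicator A x \<partial>nu)"
    by (subst nn_integral_K) (simp_all add: m.emeasure_space_1[unfolded space_m])
  finally show "emeasure (distr K nu fst) A = emeasure nu A" by simp
qed simp

lemma distr_swap: "distr K K prod.swap = K"
  using reversible unfolding reversible_def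
  by (metis distr_cong sets_K)

lemma swap_measurable[measurable]: "prod.swap \<in> K \<rightarrow>\<^sub>M K"
proof -
  have "prod.swap = (\<lambda>p :: 'a \<times> 'a. (snd p, fst p))" by auto
  then show ?thesis by (rule ssubst) measurable
qed

lemma distr_snd: "distr K nu snd = nu"
proof -
  have "nu = distr (distr K K prod.swap) nu fst"
    by (simp add: distr_swap distr_fst)
  also have "\<dots> = distr K nu snd"
    by (subst distr_distr) (simp_all add: comp_def)
  finally show ?thesis by simp
qed

sublocale K: finite_measure K
proof
  have "emeasure nu UNIV = emeasure K UNIV"
    by (subst distr_fst[symmetric], subst emeasure_distr) simp_all
  then show "emeasure K (space K) \<noteq> \<infinity>"
    using nu.emeasure_finite[of UNIV] by simp
qed

lemma AE_K_swap:
  assumes "AE p in K. P p" shows "AE p in K. P (prod.swap p)"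
proof (rule AE_distrD[OF swap_measurable])
  show "AE p in distr K K prod.swap. P p" by (subst distr_swap) (rule assms)
qed

lemma integral_K_swap:
  fixes h :: "'a \<times> 'a \<Rightarrow> real"
  assumes "h \<in> borel_measurable K"
  shows "(\<integral>p. h (prod.swap p) \<partial>K) = (\<integral>p. h p \<partial>K)"
  using integral_distr[OF swap_measurable assms] by (simp add: distr_swap)

lemma AE_K_ends:
  assumes "AE x in nu. P x"
  shows "AE p in K. P (fst p)" "AE p in K. P (snd p)"
proof -
  have "AE x in distr K nu fst. P x" "AE x in distr K nu snd. P x"
    using assms by (subst distr_fst distr_snd, assumption)+
  then show "AE p in K. P (fst p)" "AE p in K. P (snd p)"
    by (auto dest!: AE_distrD[rotated])
qed

lemma integrable_K_ends:
  fixes u :: "'a \<Rightarrow> real"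
  assumes "integrable nu u"
  shows "integrable K (\<lambda>p. u (fst p))" "integrable K (\<lambda>p. u (snd p))"
  using integrable_distr[of fst K nu u] integrable_distr[of snd K nu u] assms
  by (simp_all add: distr_fst distr_snd)

lemma kernel_integral_measurable[measurable]:
  fixes h :: "'a \<times> 'a \<Rightarrow> real"
  assumes [measurable]: "h \<in> borel_measurable (borel \<Otimes>\<^sub>M borel)"
  shows "(\<lambda>x. \<integral>y. h (x, y) \<partial>m x) \<in> borel_measurable borel"
proof -
  have "(\<lambda>x. \<integral>p. h p \<partial>distr (m x) (borel \<Otimes>\<^sub>M borel) (Pair x)) \<in> borel_measurable borel"
    by (rule measurable_compose[OF Pair_kernel_measurable integral_measurable_subprob_algebra]) measurable
  then show ?thesis
    by (simp add: integral_distr)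
qed

text \<open>
  Fubini's theorem for \<open>K\<close>, first for nonnegative functions, where it follows from the
  corresponding identity for nonnegative integrals.
\<close>

lemma integral_K_nonneg:
  fixes h :: "'a \<times> 'a \<Rightarrow> real"
  assumes [measurable]: "integrable K h" and nonneg: "\<And>p. 0 \<le> h p"
  shows "integrable nu (\<lambda>x. \<integral>y. h (x, y) \<partial>m x)"
    "(\<integral>p. h p \<partial>K) = (\<integral>x. (\<integral>y. h (x, y) \<partial>m x) \<partial>nu)"
    "AE x in nu. integrable (m x) (\<lambda>y. h (x, y))"
proof -
  have h[measurable]: "h \<in> borel_measurable (borel \<Otimes>\<^sub>M borel)"
    using borel_measurable_integrable[OF assms(1)] by simp
  have meas[measurable]: "(\<lambda>x. \<integral>y. h (x, y) \<partial>m x) \<in> borel_measurable borel"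
    by (rule kernel_integral_measurable) measurable
  have eq: "(\<integral>\<^sup>+ x. (\<integral>\<^sup>+ y. h (x, y) \<partial>m x) \<partial>nu) = ennreal (\<integral>p. h p \<partial>K)"
    using nn_integral_eq_integral[OF assms(1)] nonneg by (subst nn_integral_K[symmetric]) auto
  have "(\<lambda>x. \<integral>\<^sup>+ y. ennreal (h (x, y)) \<partial>m x) \<in> borel_measurable borel"
    by (rule nn_integral_measurable_subprob_algebra2[where N = borel]) measurable
  then have "AE x in nu. (\<integral>\<^sup>+ y. h (x, y) \<partial>m x) \<noteq> \<infinity>"
    using eq by (intro nn_integral_PInf_AE) (auto cong: measurable_cong_sets)
  then show int: "AE x in nu. integrable (m x) (\<lambda>y. h (x, y))"
  proof eventually_elim
    case (elim x)
    then show ?case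
      by (intro integrableI_nonneg) (auto simp: nonneg top.not_eq_extremum)
  qed
  have "(\<integral>\<^sup>+ x. (\<integral>y. h (x, y) \<partial>m x) \<partial>nu) = (\<integral>\<^sup>+ x. (\<integral>\<^sup>+ y. h (x, y) \<partial>m x) \<partial>nu)"
    by (rule nn_integral_cong_AE) (use int in \<open>eventually_elim, simp add: nn_integral_eq_integral nonneg\<close>)
  then have nn: "(\<integral>\<^sup>+ x. (\<integral>y. h (x, y) \<partial>m x) \<partial>nu) = ennreal (\<integral>p. h p \<partial>K)"
    using eq by simp
  show "integrable nu (\<lambda>x. \<integral>y. h (x, y) \<partial>m x)"
    by (rule integrableI_nonneg) (auto simp: nn nonneg cong: measurable_cong_sets)
  show "(\<integral>p. h p \<partial>K) = (\<integral>x. (\<integral>y. h (x, y) \<partial>m x) \<partial>nu)"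
    by (subst integral_eq_nn_integral)
      (auto simp: nn nonneg cong: measurable_cong_sets)
qed

lemma integral_K:
  fixes h :: "'a \<times> 'a \<Rightarrow> real"
  assumes h: "integrable K h"
  shows "(\<integral>p. h p \<partial>K) = (\<integral>x. (\<integral>y. h (x, y) \<partial>m x) \<partial>nu)"
proof -
  let ?P = "\<lambda>p. max 0 (h p)" and ?N = "\<lambda>p. max 0 (- h p)"
  have P: "integrable K ?P" and N: "integrable K ?N"
    using h by auto
  note FP = integral_K_nonneg[OF P] and FN = integral_K_nonneg[OF N]
  have split: "h p = ?P p - ?N p" for p by auto
  have "(\<integral>p. h p \<partial>K) = (\<integral>p. ?P p \<partial>K) - (\<integral>p. ?N p \<partial>K)"
    using P N by (subst split) simp
  also have "\<dots> = (\<integral>x. (\<integral>y. ?P (x, y) \<partial>m x) - (\<integral>y. ?N (x, y) \<partial>m x) \<partial>nu)"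
    using FP(1) FN(1) by (simp add: FP(2) FN(2))
  also have "\<dots> = (\<integral>x. (\<integral>y. h (x, y) \<partial>m x) \<partial>nu)"
  proof (rule integral_cong_AE)
    have "AE x in nu. integrable (m x) (\<lambda>y. ?P (x, y))" "AE x in nu. integrable (m x) (\<lambda>y. ?N (x, y))"
      using FP(3) FN(3) by auto
    then show "AE x in nu. (\<integral>y. ?P (x, y) \<partial>m x) - (\<integral>y. ?N (x, y) \<partial>m x) = (\<integral>y. h (x, y) \<partial>m x)"
    proof eventually_elim
      case (elim x)
      then show ?case
        using Bochner_Integration.integral_diff[OF elim] by (simp flip: split)
    qed
    have [measurable]: "h \<in> borel_measurable (borel \<Otimes>\<^sub>M borel)"
      using borel_measurable_integrable[OF h] by simp
    have "(\<lambda>x. \<integral>y. h (x, y) \<partial>m x) \<in> borel_measurable borel"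
      by (rule kernel_integral_measurable) measurable
    then show "(\<lambda>x. \<integral>y. h (x, y) \<partial>m x) \<in> borel_measurable nu"
      by (simp cong: measurable_cong_sets)
  qed (use FP(1) FN(1) in auto)
  finally show ?thesis .
qed

section \<open>Divergence of flows\<close>

lemma flow_measurable_K: "g \<in> flows \<Longrightarrow> g \<in> borel_measurable K"
  using flowsD(1) by (simp cong: measurable_cong_sets)

lemma flow_slice:
  assumes "g \<in> flows"
  shows "integrable (m x) (\<lambda>y. g (x, y))"
proof (rule m.integrable_const_bound[where B = 1])
  show "AE y in m x. norm (g (x, y)) \<le> 1"
    using flowsD(2)[OF assms] by simp
  show "(\<lambda>y. g (x, y)) \<in> borel_measurable (m x)"
    using measurable_Pair2[OF flowsD(1)[OF assms], of x] by (simp cong: measurable_cong_sets)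
qed

text \<open>
  The divergence is half the integral of \<open>g(x,y) - g(y,x)\<close>, and antisymmetry makes that integrand
  \<open>2 g(x,y)\<close>. In this form linearity, measurability and the bound by 1 are immediate.
\<close>

lemma m_div_flow:
  assumes "g \<in> flows"
  shows "m_div m g x = (\<integral>y. g (x, y) \<partial>m x)"
proof -
  have "(\<lambda>y. g (x, y) - g (y, x)) = (\<lambda>y. 2 * g (x, y))"
    using flowsD(3)[OF assms, of _ x] by (intro ext) simp
  then show ?thesis by (simp add: m_div_def)
qed

lemma m_div_flow_measurable: "g \<in> flows \<Longrightarrow> m_div m g \<in> borel_measurable nu"
  using kernel_integral_measurable[OF flowsD(1), of g]
  by (subst measurable_cong[OF m_div_flow]) (simp_all cong: measurable_cong_sets)

lemma m_div_flow_bounded: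
  assumes "g \<in> flows" shows "\<bar>m_div m g x\<bar> \<le> 1"
proof -
  have "\<bar>\<integral>y. g (x, y) \<partial>m x\<bar> \<le> (\<integral>y. \<bar>g (x, y)\<bar> \<partial>m x)"
    by (rule integral_abs_bound)
  also have "\<dots> \<le> (\<integral>y. 1 \<partial>m x)"
    using flow_slice[OF assms] by (intro integral_mono flowsD(2)[OF assms]) auto
  finally have "\<bar>\<integral>y. g (x, y) \<partial>m x\<bar> \<le> (\<integral>y. 1 \<partial>m x)" .
  then show ?thesis
    by (simp add: m_div_flow[OF assms] m.prob_space[unfolded space_m])
qed

lemma m_div_flow_L2: "g \<in> flows \<Longrightarrow> m_div m g \<in> L2 nu"
  by (rule nu.bounded_L2[OF m_div_flow_measurable m_div_flow_bounded])

lemma m_div_flow_convex: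
  assumes "g \<in> flows" "h \<in> flows" "0 \<le> t" "t \<le> 1"
  shows "m_div m (\<lambda>p. (1 - t) * g p + t * h p) x = (1 - t) * m_div m g x + t * m_div m h x"
  using flow_slice[OF assms(1), of x] flow_slice[OF assms(2), of x]
  by (simp add: m_div_flow assms m_div_flow[OF flows_convex[OF assms]])

text \<open>
  The competitors in the theorem are antisymmetric and bounded only almost everywhere. Antisymmetrising
  and then truncating at \<open>\<plusminus>1\<close> changes such a function on a null set only. Because \<open>K\<close> is symmetric, the
  values at \<open>(y,x)\<close> also change on a null set only, so the divergence is unaffected.
\<close>

lemma antisymmetric_representative:
  assumes g: "g \<in> Linf K" and anti: "antisymmetric K g" and norm: "Linf_norm K g \<le> 1"
  obtains h where "h \<in> flows" "AE p in K. h p = g p" "AE x in nu. m_div m h x = m_div m g x"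
proof -
  have gm[measurable]: "g \<in> borel_measurable (borel \<Otimes>\<^sub>M borel)"
    using g by (simp add: Linf_def cong: measurable_cong_sets)
  define h where "h p = max (-1) (min 1 ((g p - g (snd p, fst p)) / 2))" for p
  have hm[measurable]: "h \<in> borel_measurable (borel \<Otimes>\<^sub>M borel)"
    unfolding h_def by measurable
  have "max (-1) (min 1 ((b - a) / 2)) = - max (-1) (min 1 ((a - b) / 2))" for a b :: real
    by (simp add: max_def min_def field_simps)
  then have "h (y, x) = - h (x, y)" for x y
    unfolding h_def fst_conv snd_conv .
  moreover have "\<bar>h p\<bar> \<le> 1" for p
    by (auto simp: h_def)
  ultimately have h: "h \<in> flows"
    using hm unfolding flows_def by blast
  have "AE p in K. ereal \<bar>g p\<bar> \<le> 1"
    using esssup_AE by (rule eventually_mono) (rule order_trans[OF _ norm[unfolded Linf_norm_def]])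
  then have hg: "AE p in K. h p = g p"
    using anti unfolding antisymmetric_def
  proof eventually_elim
    case (elim p)
    then show ?case by (cases p) (simp add: h_def)
  qed
  moreover have "AE x in nu. m_div m h x = m_div m g x"
  proof -
    have "AE p in K. h p = g p \<and> h (prod.swap p) = g (prod.swap p)"
      using hg AE_K_swap[OF hg] by eventually_elim simp
    from AE_K_slices[OF this] show ?thesis
    proof eventually_elim
      case (elim x)
      have "(\<integral>y. h (x, y) - h (y, x) \<partial>m x) = (\<integral>y. g (x, y) - g (y, x) \<partial>m x)"
        by (rule integral_cong_AE) (use elim in \<open>auto elim: eventually_mono\<close>)
      then show ?case by (simp add: m_div_def)
    qed
  qed
  ultimately show ?thesis using that h by blast
qed

section \<open>Total variation and its calibration by flows\<close>

text \<open>
  On integrable functions this is \<open>TV\<close> as a real number; as an integral against the symmetric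
  measure \<open>K\<close> it can be compared directly with the pairing of \<open>u\<close> and a flow.
\<close>

definition tv :: "('a \<Rightarrow> real) \<Rightarrow> real" where
  "tv u = 1/2 * (\<integral>p. \<bar>u (snd p) - u (fst p)\<bar> \<partial>K)"

lemma integrable_difference:
  fixes u :: "'a \<Rightarrow> real"
  assumes "integrable nu u"
  shows "integrable K (\<lambda>p. u (snd p) - u (fst p))"
  using integrable_K_ends[OF assms] by simp

lemma integrable_flow_difference:
  assumes "g \<in> flows" "integrable nu u"
  shows "integrable K (\<lambda>p. g p * (u (snd p) - u (fst p)))"
proof (rule Bochner_Integration.integrable_bound[OF integrable_difference[OF assms(2)]])
  show "(\<lambda>p. g p * (u (snd p) - u (fst p))) \<in> borel_measurable K"
    using flow_measurable_K[OF assms(1)] borel_measurable_integrable[OF integrable_difference[OF assms(2)]]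
    by simp
  show "AE p in K. norm (g p * (u (snd p) - u (fst p))) \<le> norm (u (snd p) - u (fst p))"
    using flowsD(2)[OF assms(1)] by (auto simp: abs_mult intro!: AE_I2 mult_left_le_one_le)
qed

lemma TV_eq_tv:
  assumes u: "integrable nu u"
  shows "TV nu m u = ennreal (tv u)"
proof -
  have [measurable]: "u \<in> borel_measurable borel"
    using borel_measurable_integrable[OF u] by (simp cong: measurable_cong_sets)
  have "(\<integral>\<^sup>+ x. (\<integral>\<^sup>+ y. ennreal \<bar>u y - u x\<bar> \<partial>m x) \<partial>nu)
      = (\<integral>\<^sup>+ p. ennreal \<bar>u (snd p) - u (fst p)\<bar> \<partial>K)"
    by (subst nn_integral_K) simp_all
  also have "\<dots> = ennreal (\<integral>p. \<bar>u (snd p) - u (fst p)\<bar> \<partial>K)"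
    using integrable_difference[OF u] by (intro nn_integral_eq_integral) auto
  finally show ?thesis
    by (simp only: TV_def tv_def) (rule ennreal_mult[symmetric], simp_all)
qed

lemma TV_functional_eq_tv:
  assumes "u \<in> L2 nu"
  shows "TV_functional nu m u = ereal (tv u)"
  using TV_eq_tv[OF nu.L2_integrable[OF assms]] by (simp add: TV_functional_def tv_def)

text \<open>
  By Fubini the left-hand side is the integral of \<open>g(x,y) u(x)\<close>. Exchanging the variables turns this
  into minus the integral of \<open>g(x,y) u(y)\<close>; the right-hand side is the mean of the two expressions.
\<close>

lemma integral_m_div_by_parts:
  assumes g: "g \<in> flows" and u: "integrable nu u"
  shows "(\<integral>x. u x * m_div m g x \<partial>nu) = - (1/2 * (\<integral>p. g p * (u (snd p) - u (fst p)) \<partial>K))"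
proof -
  have dom: "integrable K (\<lambda>p. g p * v p)" if v: "integrable K v" for v
  proof (rule Bochner_Integration.integrable_bound[OF v])
    show "AE p in K. norm (g p * v p) \<le> norm (v p)"
      using flowsD(2)[OF g] by (auto simp: abs_mult intro!: AE_I2 mult_left_le_one_le)
  qed (use flow_measurable_K[OF g] borel_measurable_integrable[OF v] in simp)
  note i1 = dom[OF integrable_K_ends(1)[OF u]] and i2 = dom[OF integrable_K_ends(2)[OF u]]
  have "(\<integral>x. u x * m_div m g x \<partial>nu) = (\<integral>x. (\<integral>y. g (x, y) * u x \<partial>m x) \<partial>nu)"
    by (simp add: m_div_flow[OF g] mult.commute)
  also have "\<dots> = (\<integral>p. g p * u (fst p) \<partial>K)"
    using integral_K[OF i1] by simp
  finally have 1: "(\<integral>x. u x * m_div m g x \<partial>nu) = (\<integral>p. g p * u (fst p) \<partial>K)" .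
  have swap: "g (prod.swap p) = - g p" for p
    by (cases p) (simp, rule flowsD(3)[OF g])
  have "(\<integral>p. g p * u (snd p) \<partial>K) = (\<integral>p. g (prod.swap p) * u (snd (prod.swap p)) \<partial>K)"
    by (rule integral_K_swap[symmetric]) (rule borel_measurable_integrable[OF i2])
  also have "\<dots> = - (\<integral>p. g p * u (fst p) \<partial>K)"
    by (simp add: swap)
  finally have "(\<integral>p. g p * u (snd p) \<partial>K) = - (\<integral>p. g p * u (fst p) \<partial>K)" .
  then show ?thesis
    using i1 i2 by (simp add: 1 right_diff_distrib)
qed

lemma minus_integral_m_div_le_tv:
  assumes g: "g \<in> flows" and u: "integrable nu u"
  shows "- (\<integral>x. u x * m_div m g x \<partial>nu) \<le> tv u"
proof -
  have "(\<integral>p. g p * (u (snd p) - u (fst p)) \<partial>K) \<le> (\<integral>p. \<bar>u (snd p) - u (fst p)\<bar> \<partial>K)"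
  proof (rule integral_mono)
    show "g p * (u (snd p) - u (fst p)) \<le> \<bar>u (snd p) - u (fst p)\<bar>" for p
      by (rule mult_le_abs[OF flowsD(2)[OF g]])
  qed (use integrable_flow_difference[OF g u] integrable_difference[OF u] in auto)
  then show ?thesis
    by (simp add: integral_m_div_by_parts[OF g u] tv_def)
qed

text \<open>
  The difference of the two sides is half the integral of the nonnegative function
  \<open>\<bar>d\<bar> - g d\<close> with \<open>d = u(y) - u(x)\<close>, so it vanishes only if this function is zero almost everywhere.
\<close>

lemma minus_integral_m_div_eq_tv_iff:
  assumes g: "g \<in> flows" and u: "integrable nu u"
  shows "- (\<integral>x. u x * m_div m g x \<partial>nu) = tv u
    \<longleftrightarrow> (AE p in K. g p \<in> msign (u (snd p) - u (fst p)))"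
proof -
  let ?d = "\<lambda>p. u (snd p) - u (fst p)"
  let ?h = "\<lambda>p. \<bar>?d p\<bar> - g p * ?d p"
  have int: "integrable K ?h"
    using integrable_flow_difference[OF g u] integrable_difference[OF u] by auto
  have "g p * ?d p \<le> \<bar>?d p\<bar>" for p
    by (rule mult_le_abs[OF flowsD(2)[OF g]])
  then have nonneg: "0 \<le> ?h p" for p by simp
  have "(\<integral>p. ?h p \<partial>K) = 2 * (tv u + (\<integral>x. u x * m_div m g x \<partial>nu))"
    using integrable_flow_difference[OF g u] integrable_difference[OF u]
    by (simp add: integral_m_div_by_parts[OF g u] tv_def)
  then have "- (\<integral>x. u x * m_div m g x \<partial>nu) = tv u \<longleftrightarrow> (\<integral>p. ?h p \<partial>K) = 0"
    by auto
  also have "\<dots> \<longleftrightarrow> (AE p in K. ?h p = 0)"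
    using int nonneg by (intro integral_nonneg_eq_0_iff_AE) auto
  also have "\<dots> \<longleftrightarrow> (AE p in K. g p \<in> msign (?d p))"
    by (intro AE_cong) (auto simp: msign_iff[OF flowsD(2)[OF g]])
  finally show ?thesis .
qed

section \<open>The dual problem\<close>

text \<open>
  The limit is redefined as 0 where the sequence diverges. By antisymmetry of the sequence the
  set of divergence is symmetric, so the limit is again antisymmetric at every point. Flows are
  dominated by 1, hence their divergences converge too.
\<close>

lemma flow_limit:
  assumes p: "\<And>n. p n \<in> flows" and conv: "AE q in K. convergent (\<lambda>n. p n q)"
  obtains g where "g \<in> flows" "AE x in nu. (\<lambda>n. m_div m (p n) x) \<longlonglongrightarrow> m_div m g x"
proof -
  have pm[measurable]: "p n \<in> borel_measurable (borel \<Otimes>\<^sub>M borel)" for n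
    by (rule flowsD(1)[OF p])
  define g where "g q = (if Cauchy (\<lambda>n. p n q) then lim (\<lambda>n. p n q) else 0)" for q
  have "g \<in> borel_measurable (borel \<Otimes>\<^sub>M borel)"
    unfolding g_def by measurable
  moreover have lim: "(\<lambda>n. p n q) \<longlonglongrightarrow> g q" if "Cauchy (\<lambda>n. p n q)" for q
    using that by (simp add: g_def Cauchy_convergent_iff convergent_LIMSEQ_iff)
  have "\<bar>g q\<bar> \<le> 1" for q
  proof (cases "Cauchy (\<lambda>n. p n q)")
    case True
    show ?thesis
      by (rule LIMSEQ_le_const2[OF tendsto_rabs[OF lim[OF True]]]) (use flowsD(2)[OF p] in auto)
  qed (simp add: g_def)
  moreover have "g (y, x) = - g (x, y)" for x y
  proof -
    have eq: "(\<lambda>n. p n (y, x)) = (\<lambda>n. - p n (x, y))"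
      by (rule ext) (rule flowsD(3)[OF p])
    show ?thesis
    proof (cases "Cauchy (\<lambda>n. p n (x, y))")
      case True
      then have "(\<lambda>n. p n (y, x)) \<longlonglongrightarrow> - g (x, y)"
        unfolding eq by (intro tendsto_minus lim)
      moreover from this have "Cauchy (\<lambda>n. p n (y, x))"
        by (rule LIMSEQ_imp_Cauchy)
      ultimately show ?thesis using lim LIMSEQ_unique by blast
    next
      case False
      have "\<not> Cauchy (\<lambda>n. p n (y, x))"
      proof
        assume "Cauchy (\<lambda>n. p n (y, x))"
        then have "convergent (\<lambda>n. - p n (x, y))"
          unfolding eq by (simp only: Cauchy_convergent_iff)
        then have "Cauchy (\<lambda>n. p n (x, y))"
          by (simp only: Cauchy_convergent_iff convergent_minus_iff[of "\<lambda>n. p n (x, y)"])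
        with False show False ..
      qed
      with False show ?thesis by (simp add: g_def)
    qed
  qed
  ultimately have g: "g \<in> flows"
    unfolding flows_def by blast
  have "AE q in K. (\<lambda>n. p n q) \<longlonglongrightarrow> g q"
    using conv by eventually_elim (simp add: lim Cauchy_convergent_iff)
  from AE_K_slices[OF this] have "AE x in nu. (\<lambda>n. m_div m (p n) x) \<longlonglongrightarrow> m_div m g x"
  proof eventually_elim
    case (elim x)
    have "(\<lambda>n. \<integral>y. p n (x, y) \<partial>m x) \<longlonglongrightarrow> (\<integral>y. g (x, y) \<partial>m x)"
    proof (rule integral_dominated_convergence[where w = "\<lambda>_. 1"])
      show "AE y in m x. norm (p n (x, y)) \<le> 1" for n
        using flowsD(2)[OF p] by simp
    qed (use elim flow_slice[OF g] flow_slice[OF p] in auto)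
    then show ?case by (simp only: m_div_flow[OF g] m_div_flow[OF p])
  qed
  with g that show ?thesis by blast
qed

lemma integrable_residual_sq:
  assumes "c \<in> L2 nu" "g \<in> flows"
  shows "integrable nu (\<lambda>x. (c x + m_div m g x)\<^sup>2)"
  using L2_lincomb[OF assms(1) m_div_flow_L2[OF assms(2)], of 1 1] by (simp add: L2_iff)

text \<open>
  The sublevel sets of the functional at the heights \<open>I + 1/(n+1)\<close>, with \<open>I\<close> its infimum, are midpoint
  convex and nested, so they contain an almost everywhere convergent minimising sequence of flows; the
  functional is continuous along it by dominated convergence.
\<close>

lemma dual_minimizer_exists:
  assumes c: "c \<in> L2 nu"
  obtains g where "g \<in> flows"
    "\<And>h. h \<in> flows \<Longrightarrow> (\<integral>x. (c x + m_div m g x)\<^sup>2 \<partial>nu) \<le> (\<integral>x. (c x + m_div m h x)\<^sup>2 \<partial>nu)"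
proof -
  define J where "J g = (\<integral>x. (c x + m_div m g x)\<^sup>2 \<partial>nu)" for g
  define I where "I = Inf (J ` flows)"
  define S where "S n = {g \<in> flows. J g \<le> I + 1 / real (Suc n)}" for n
  have zero: "(\<lambda>_. 0) \<in> flows"
    by (simp add: flows_def)
  have "bdd_below (J ` flows)"
    by (rule bdd_belowI2[where m = 0]) (simp add: J_def)
  then have I_le: "I \<le> J g" if "g \<in> flows" for g
    unfolding I_def using that by (intro cInf_lower) auto
  have "\<exists>p. (\<forall>n. p n \<in> S n) \<and> (AE q in K. convergent (\<lambda>n. p n q))"
  proof (rule nested_midpoint_convex_AE_convergent[where B = 1])
    show "finite_measure K" by (rule K.finite_measure_axioms)
    show "S n \<noteq> {}" for n
    proof -
      have "Inf (J ` flows) < I + 1 / real (Suc n)" by (simp add: I_def)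
      then obtain g where "g \<in> flows" "J g < I + 1 / real (Suc n)"
        using cInf_lessD[of "J ` flows"] zero by auto
      then show ?thesis by (auto simp: S_def)
    qed
    show "decseq S"
    proof (rule decseq_SucI, rule subsetI)
      fix n g assume g: "g \<in> S (Suc n)"
      have "1 / real (Suc (Suc n)) \<le> 1 / real (Suc n)"
        by (rule divide_left_mono) auto
      then have "I + 1 / real (Suc (Suc n)) \<le> I + 1 / real (Suc n)"
        by (rule add_left_mono)
      with g show "g \<in> S n" unfolding S_def by (blast intro: order_trans)
    qed
    show "g \<in> borel_measurable K" if "g \<in> S 0" for g
      using that by (auto simp: S_def intro: flow_measurable_K)
    show "\<bar>g q\<bar> \<le> 1" if "g \<in> S 0" for g q
      using that by (auto simp: S_def intro: flowsD(2))
    fix n g h assume "g \<in> S n" "h \<in> S n"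
    then have g: "g \<in> flows" "J g \<le> I + 1 / real (Suc n)" and h: "h \<in> flows" "J h \<le> I + 1 / real (Suc n)"
      by (auto simp: S_def)
    let ?k = "\<lambda>p. (1 - 1/2) * g p + 1/2 * h p"
    have k: "?k \<in> flows" using g(1) h(1) by (rule flows_convex) auto
    have Jk: "J ?k \<le> (\<integral>x. 1/2 * (c x + m_div m g x)\<^sup>2 + 1/2 * (c x + m_div m h x)\<^sup>2 \<partial>nu)"
      unfolding J_def
    proof (rule integral_mono)
      show "(c x + m_div m ?k x)\<^sup>2 \<le> 1/2 * (c x + m_div m g x)\<^sup>2 + 1/2 * (c x + m_div m h x)\<^sup>2" for x
      proof -
        have "((a + b) / 2)\<^sup>2 \<le> 1/2 * a\<^sup>2 + 1/2 * b\<^sup>2" for a b :: real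
          using sum_squares_bound[of a b] by (simp add: power2_eq_square field_simps)
        from this[of "c x + m_div m g x" "c x + m_div m h x"] show ?thesis
          by (subst m_div_flow_convex[OF g(1) h(1)]) (auto simp: field_simps)
      qed
    qed (use integrable_residual_sq[OF c k] integrable_residual_sq[OF c g(1)]
      integrable_residual_sq[OF c h(1)] in auto)
    also have "\<dots> = 1/2 * J g + 1/2 * J h"
      using integrable_residual_sq[OF c g(1)] integrable_residual_sq[OF c h(1)]
      by (simp add: J_def)
    finally have "J ?k \<le> I + 1 / real (Suc n)"
      using g(2) h(2) by linarith
    with k have "?k \<in> S n" by (simp add: S_def)
    then show "(\<lambda>p. (g p + h p) / 2) \<in> S n"
      by (simp add: add_divide_distrib)
  qed
  then obtain p where p: "\<And>n. p n \<in> S n" and conv: "AE q in K. convergent (\<lambda>n. p n q)"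
    by blast
  have pf: "p n \<in> flows" and pJ: "J (p n) \<le> I + 1 / real (Suc n)" for n
    using p[of n] by (auto simp: S_def)
  obtain g where g: "g \<in> flows" and lim: "AE x in nu. (\<lambda>n. m_div m (p n) x) \<longlonglongrightarrow> m_div m g x"
    using flow_limit[OF pf conv] by blast
  have "(\<lambda>n. J (p n)) \<longlonglongrightarrow> J g"
    unfolding J_def
  proof (rule integral_dominated_convergence[where w = "\<lambda>x. 2 * (c x)\<^sup>2 + 2"])
    show "integrable nu (\<lambda>x. 2 * (c x)\<^sup>2 + 2)"
      using c by (simp add: L2_iff)
    show "AE x in nu. (\<lambda>n. (c x + m_div m (p n) x)\<^sup>2) \<longlonglongrightarrow> (c x + m_div m g x)\<^sup>2"
      using lim by eventually_elim (intro tendsto_intros)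
    show "AE x in nu. norm ((c x + m_div m (p n) x)\<^sup>2) \<le> 2 * (c x)\<^sup>2 + 2" for n
    proof (rule AE_I2)
      fix x
      have "(m_div m (p n) x)\<^sup>2 \<le> 1"
        using power_mono[OF m_div_flow_bounded[OF pf[of n], of x], of 2] by simp
      moreover
      have "(a + b)\<^sup>2 \<le> 2 * a\<^sup>2 + 2 * b\<^sup>2" for a b :: real
        using sum_squares_bound[of a b] by (simp add: power2_eq_square algebra_simps)
      from this[of "c x" "m_div m (p n) x"] have
        "(c x + m_div m (p n) x)\<^sup>2 \<le> 2 * (c x)\<^sup>2 + 2 * (m_div m (p n) x)\<^sup>2" .
      ultimately show "norm ((c x + m_div m (p n) x)\<^sup>2) \<le> 2 * (c x)\<^sup>2 + 2"
        by simp
    qed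
  qed (use integrable_residual_sq[OF c g] integrable_residual_sq[OF c pf] in auto)
  moreover have "(\<lambda>n. I + 1 / real (Suc n)) \<longlonglongrightarrow> I + 0"
    using LIMSEQ_inverse_real_of_nat by (intro tendsto_intros) (simp add: inverse_eq_divide)
  ultimately have "J g \<le> I + 0"
    using pJ by (intro LIMSEQ_le) auto
  then have "J g \<le> J h" if "h \<in> flows" for h
    using I_le[OF that] by linarith
  with g that show ?thesis by (auto simp: J_def)
qed

text \<open>
  First-order optimality along the segment from \<open>g\<close> to \<open>h\<close>: with \<open>a = c + div g\<close> and
  \<open>b = div h - div g\<close> the functional at parameter \<open>t\<close> exceeds its minimum by
  \<open>2 t \<integral>a b d\<nu> + t\<^sup>2 \<integral>b\<^sup>2 d\<nu>\<close>, which would be negative for small \<open>t\<close> if \<open>\<integral>a b d\<nu>\<close> were.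
\<close>

lemma dual_minimizer_variational:
  assumes c: "c \<in> L2 nu" and g: "g \<in> flows" and h: "h \<in> flows"
    and min: "\<And>h. h \<in> flows \<Longrightarrow> (\<integral>x. (c x + m_div m g x)\<^sup>2 \<partial>nu) \<le> (\<integral>x. (c x + m_div m h x)\<^sup>2 \<partial>nu)"
  shows "0 \<le> (\<integral>x. (c x + m_div m g x) * (m_div m h x - m_div m g x) \<partial>nu)" (is "0 \<le> ?A")
proof (rule ccontr)
  assume neg: "\<not> 0 \<le> ?A"
  define a where "a x = c x + m_div m g x" for x
  define b where "b x = m_div m h x - m_div m g x" for x
  define A where "A = (\<integral>x. a x * b x \<partial>nu)"
  define B where "B = (\<integral>x. (b x)\<^sup>2 \<partial>nu)"
  have a: "a \<in> L2 nu"
    unfolding a_def using L2_lincomb[OF c m_div_flow_L2[OF g], of 1 1] by simp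
  have b: "b \<in> L2 nu"
    unfolding b_def by (intro L2_diff m_div_flow_L2 g h)
  have A: "A < 0" using neg by (simp add: A_def a_def b_def)
  have B: "0 \<le> B" by (simp add: B_def)
  \<comment> \<open>Small enough for the quadratic term to compensate at most half of the negative linear one.\<close>
  define t where "t = min 1 (- A / (B + 1))"
  have t: "0 < t" "t \<le> 1" using A B by (auto simp: t_def divide_neg_pos)
  let ?k = "\<lambda>p. (1 - t) * g p + t * h p"
  have k: "?k \<in> flows" using g h by (rule flows_convex) (use t in auto)
  have "(\<integral>x. (a x)\<^sup>2 \<partial>nu) \<le> (\<integral>x. (c x + m_div m ?k x)\<^sup>2 \<partial>nu)"
    unfolding a_def by (rule min[OF k])
  also have "\<dots> = (\<integral>x. (a x)\<^sup>2 + 2 * t * (a x * b x) + t\<^sup>2 * (b x)\<^sup>2 \<partial>nu)"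
  proof (rule Bochner_Integration.integral_cong[OF refl])
    fix x
    have "m_div m ?k x = (1 - t) * m_div m g x + t * m_div m h x"
      using t by (intro m_div_flow_convex g h) auto
    then have "c x + m_div m ?k x = a x + t * b x"
      by (simp add: a_def b_def algebra_simps)
    then show "(c x + m_div m ?k x)\<^sup>2 = (a x)\<^sup>2 + 2 * t * (a x * b x) + t\<^sup>2 * (b x)\<^sup>2"
      by (simp add: power2_eq_square algebra_simps)
  qed
  also have "\<dots> = (\<integral>x. (a x)\<^sup>2 \<partial>nu) + 2 * t * A + t\<^sup>2 * B"
    using a b integrable_L2_mult[OF a b] by (simp add: A_def B_def L2_iff)
  finally have "0 \<le> t * (2 * A + t * B)"
    by (simp add: power2_eq_square algebra_simps)
  then have "0 \<le> 2 * A + t * B"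
    using t by (simp add: zero_le_mult_iff)
  moreover have "t * B \<le> - A"
  proof -
    have "t * B \<le> - A / (B + 1) * B"
      unfolding t_def by (intro mult_right_mono) (use B in auto)
    also have "\<dots> \<le> - A"
    proof -
      have "- A * (B / (B + 1)) \<le> - A * 1"
        by (rule mult_left_mono) (use A B in auto)
      then show ?thesis by simp
    qed
    finally show ?thesis .
  qed
  ultimately show False using A by linarith
qed

text \<open>
  The dual minimiser \<open>g\<close> is tested against the flow \<open>sgn(u(y) - u(x))\<close>, which is the one that attains the
  total variation of \<open>u = f + div g / lam\<close>. Optimality forces \<open>g\<close> to attain it as well.
\<close>

lemma solution_exists:
  assumes f: "f \<in> L2 nu" and lam: "lam > 0"
  obtains u g where "u \<in> L2 nu" "g \<in> flows" "\<And>x. lam * (u x - f x) = m_div m g x"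
    "AE p in K. g p \<in> msign (u (snd p) - u (fst p))"
proof -
  have c: "(\<lambda>x. lam * f x) \<in> L2 nu" using f by (rule L2_cmult)
  obtain g where g: "g \<in> flows"
    and min: "\<And>h. h \<in> flows \<Longrightarrow>
      (\<integral>x. (lam * f x + m_div m g x)\<^sup>2 \<partial>nu) \<le> (\<integral>x. (lam * f x + m_div m h x)\<^sup>2 \<partial>nu)"
    using dual_minimizer_exists[OF c] by blast
  define u where "u x = f x + m_div m g x / lam" for x
  have lam_u: "lam * f x + m_div m g x = lam * u x" for x
    using lam by (simp add: u_def field_simps)
  have u: "u \<in> L2 nu"
    unfolding u_def using L2_lincomb[OF f m_div_flow_L2[OF g], of 1 "1 / lam"] by simp
  then have ui: "integrable nu u" by (rule nu.L2_integrable)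
  have [measurable]: "u \<in> borel_measurable borel"
    using u by (simp add: L2_iff cong: measurable_cong_sets)
  define h where "h = (\<lambda>p. sgn (u (snd p) - u (fst p)))"
  have h: "h \<in> flows"
  proof -
    have "h \<in> borel_measurable (borel \<Otimes>\<^sub>M borel)" unfolding h_def by measurable
    moreover have "\<bar>h (x, y)\<bar> \<le> 1 \<and> h (y, x) = - h (x, y)" for x y
      by (simp add: h_def sgn_if)
    ultimately show ?thesis unfolding flows_def by blast
  qed
  have "AE p in K. h p \<in> msign (u (snd p) - u (fst p))"
    by (auto simp: h_def msign_def sgn_if)
  then have hu: "- (\<integral>x. u x * m_div m h x \<partial>nu) = tv u"
    by (simp only: minus_integral_m_div_eq_tv_iff[OF h ui])
  note ig = integrable_L2_mult[OF u m_div_flow_L2[OF g]] and ih = integrable_L2_mult[OF u m_div_flow_L2[OF h]]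
  have "0 \<le> (\<integral>x. lam * u x * (m_div m h x - m_div m g x) \<partial>nu)"
    using dual_minimizer_variational[OF c g h min] by (simp add: lam_u)
  also have "\<dots> = (\<integral>x. lam * (u x * m_div m h x - u x * m_div m g x) \<partial>nu)"
    by (simp add: algebra_simps)
  also have "\<dots> = lam * ((\<integral>x. u x * m_div m h x \<partial>nu) - (\<integral>x. u x * m_div m g x \<partial>nu))"
    using ig ih by simp
  finally have "(\<integral>x. u x * m_div m g x \<partial>nu) \<le> (\<integral>x. u x * m_div m h x \<partial>nu)"
    using lam by (simp add: zero_le_mult_iff)
  with hu minus_integral_m_div_le_tv[OF g ui] have "- (\<integral>x. u x * m_div m g x \<partial>nu) = tv u"
    by linarith
  then have "AE p in K. g p \<in> msign (u (snd p) - u (fst p))"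
    by (simp only: minus_integral_m_div_eq_tv_iff[OF g ui])
  moreover have "lam * (u x - f x) = m_div m g x" for x
    using lam by (simp add: u_def)
  ultimately show ?thesis using that u g by blast
qed

section \<open>The primal problem and the inclusion\<close>

text \<open>
  Pairing \<open>w\<close> with \<open>- div g\<close> gives a linear minorant of the total variation that touches it at \<open>u\<close>,
  and this is what a subgradient is.
\<close>

lemma flow_imp_one_laplacian:
  assumes u: "u \<in> L2 nu" and v: "v \<in> L2 nu" and g: "g \<in> flows"
    and div: "AE x in nu. v x = m_div m g x"
    and sign: "AE p in K. g p \<in> msign (u (snd p) - u (fst p))"
  shows "v \<in> one_laplacian nu m u"
proof -
  have "tv u + (\<integral>x. - v x * (w x - u x) \<partial>nu) \<le> tv w" if w: "w \<in> L2 nu" for w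
  proof -
    have gL: "m_div m g \<in> L2 nu" by (rule m_div_flow_L2[OF g])
    have "(\<integral>x. - v x * (w x - u x) \<partial>nu)
        = (\<integral>x. u x * m_div m g x - w x * m_div m g x \<partial>nu)"
      using div u v w gL
      by (intro integral_cong_AE) (auto simp: L2_iff algebra_simps elim!: eventually_mono)
    also have "\<dots> = (\<integral>x. u x * m_div m g x \<partial>nu) - (\<integral>x. w x * m_div m g x \<partial>nu)"
      using integrable_L2_mult[OF u gL] integrable_L2_mult[OF w gL] by simp
    finally show ?thesis
      using minus_integral_m_div_le_tv[OF g nu.L2_integrable[OF w]]
        minus_integral_m_div_eq_tv_iff[OF g nu.L2_integrable[OF u]] sign by simp
  qed
  moreover have "(\<lambda>x. - v x) \<in> L2 nu" using L2_cmult[OF v, of "-1"] by simp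
  ultimately show ?thesis
    using u by (simp add: one_laplacian_def L2_subdifferential_def TV_functional_eq_tv)
qed

definition rof :: "real \<Rightarrow> ('a \<Rightarrow> real) \<Rightarrow> ('a \<Rightarrow> real) \<Rightarrow> real" where
  "rof lam f u = tv u + lam/2 * (\<integral>x. (u x - f x)\<^sup>2 \<partial>nu)"

lemma ROF_energy_eq_rof:
  assumes "f \<in> L2 nu" "u \<in> L2 nu" "lam > 0"
  shows "ROF_energy nu m lam f u = ennreal (rof lam f u)" "0 \<le> rof lam f u"
proof -
  have "(\<integral>\<^sup>+ x. ennreal (\<bar>u x - f x\<bar>\<^sup>2) \<partial>nu) = ennreal (\<integral>x. (u x - f x)\<^sup>2 \<partial>nu)"
    using L2_diff[OF assms(2,1)] by (subst nn_integral_eq_integral[symmetric]) (auto simp: L2_iff)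
  moreover have "ennreal (lam/2) * ennreal (\<integral>x. (u x - f x)\<^sup>2 \<partial>nu)
      = ennreal (lam/2 * (\<integral>x. (u x - f x)\<^sup>2 \<partial>nu))"
    using assms(3) by (intro ennreal_mult[symmetric]) auto
  moreover have "0 \<le> tv u" by (simp add: tv_def)
  ultimately show "ROF_energy nu m lam f u = ennreal (rof lam f u)" "0 \<le> rof lam f u"
    using assms(3)
    by (simp_all add: ROF_energy_def rof_def TV_eq_tv[OF nu.L2_integrable[OF assms(2)]])
qed

text \<open>
  Expanding \<open>(w - f)\<^sup>2\<close> around \<open>u - f\<close> produces a linear term which the subgradient inequality absorbs;
  the quadratic term \<open>(w - u)\<^sup>2\<close> remains. It gives minimality of \<open>u\<close> as well as uniqueness.
\<close>

lemma one_laplacian_energy_gap: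
  assumes f: "f \<in> L2 nu" and w: "w \<in> L2 nu"
    and lap: "(\<lambda>x. lam * (u x - f x)) \<in> one_laplacian nu m u"
  shows "rof lam f u + lam/2 * (\<integral>x. (w x - u x)\<^sup>2 \<partial>nu) \<le> rof lam f w"
proof -
  have u: "u \<in> L2 nu"
    and sub: "TV_functional nu m u + ereal (\<integral>x. - (lam * (u x - f x)) * (w x - u x) \<partial>nu) \<le> TV_functional nu m w"
    using lap w by (auto simp: one_laplacian_def L2_subdifferential_def)
  have uf: "(\<lambda>x. u x - f x) \<in> L2 nu" and wu: "(\<lambda>x. w x - u x) \<in> L2 nu"
    by (intro L2_diff u f w)+
  note prod = integrable_L2_mult[OF uf wu]
  have "(\<integral>x. - (lam * (u x - f x)) * (w x - u x) \<partial>nu) = - lam * (\<integral>x. (u x - f x) * (w x - u x) \<partial>nu)"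
    by (simp add: mult.assoc)
  with sub have 1: "tv u - lam * (\<integral>x. (u x - f x) * (w x - u x) \<partial>nu) \<le> tv w"
    by (simp add: TV_functional_eq_tv u w)
  have "(\<integral>x. (w x - f x)\<^sup>2 \<partial>nu)
      = (\<integral>x. (u x - f x)\<^sup>2 + 2 * ((u x - f x) * (w x - u x)) + (w x - u x)\<^sup>2 \<partial>nu)"
    by (intro Bochner_Integration.integral_cong) (auto simp: power2_eq_square algebra_simps)
  also have "\<dots> = (\<integral>x. (u x - f x)\<^sup>2 \<partial>nu) + 2 * (\<integral>x. (u x - f x) * (w x - u x) \<partial>nu)
      + (\<integral>x. (w x - u x)\<^sup>2 \<partial>nu)"
    using uf wu prod by (simp add: L2_iff)
  finally show ?thesis
    using 1 by (simp add: rof_def algebra_simps)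
qed

lemma one_laplacian_imp_ROF_minimizer:
  assumes f: "f \<in> L2 nu" and lam: "lam > 0"
    and lap: "(\<lambda>x. lam * (u x - f x)) \<in> one_laplacian nu m u"
  shows "ROF_minimizer nu m lam f u"
proof -
  have u: "u \<in> L2 nu" using lap by (simp add: one_laplacian_def L2_subdifferential_def)
  have "rof lam f u \<le> rof lam f w" if "w \<in> L2 nu" for w
  proof -
    have "0 \<le> lam/2 * (\<integral>x. (w x - u x)\<^sup>2 \<partial>nu)" using lam by simp
    then show ?thesis using one_laplacian_energy_gap[OF f that lap] by linarith
  qed
  then show ?thesis
    using u lam by (auto simp: ROF_minimizer_def ROF_energy_eq_rof[OF f] intro!: ennreal_leI)
qed

lemma ROF_minimizer_unique:
  assumes f: "f \<in> L2 nu" and lam: "lam > 0"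
    and lap: "(\<lambda>x. lam * (u x - f x)) \<in> one_laplacian nu m u"
    and min: "ROF_minimizer nu m lam f w"
  shows "AE x in nu. w x = u x"
proof -
  have u: "u \<in> L2 nu" using lap by (simp add: one_laplacian_def L2_subdifferential_def)
  have w: "w \<in> L2 nu" using min by (simp add: ROF_minimizer_def)
  have "ROF_energy nu m lam f w \<le> ROF_energy nu m lam f u"
    using min u by (simp add: ROF_minimizer_def)
  then have "rof lam f w \<le> rof lam f u"
    using ROF_energy_eq_rof[OF f u lam] ROF_energy_eq_rof[OF f w lam] by simp
  then have "lam/2 * (\<integral>x. (w x - u x)\<^sup>2 \<partial>nu) \<le> 0"
    using one_laplacian_energy_gap[OF f w lap] by linarith
  then have "(\<integral>x. (w x - u x)\<^sup>2 \<partial>nu) \<le> 0"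
    using lam by (simp add: mult_le_0_iff)
  then have "(\<integral>x. (w x - u x)\<^sup>2 \<partial>nu) = 0"
    by (intro antisym) auto
  then have "AE x in nu. (w x - u x)\<^sup>2 = 0"
    using L2_diff[OF w u] by (subst (asm) integral_nonneg_eq_0_iff_AE) (auto simp: L2_iff)
  then show ?thesis by eventually_elim simp
qed

end

section \<open>Existence, uniqueness and characterisation\<close>

theorem theorem2p1:
  fixes m :: "'a::polish_space \<Rightarrow> 'a measure"
    and nu :: "'a measure"
    and f :: "'a \<Rightarrow> real"
    and lam :: real
  assumes "random_walk m"
    and "sets nu = sets borel" and "finite_measure nu" and "emeasure nu UNIV \<noteq> 0"
    and "reversible nu m"
    and "ergodic nu m"
    and "f \<in> L2 nu"
    and "lam > 0"
  shows "(\<exists>ul.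
           (ROF_minimizer nu m lam f ul \<and>
            (\<forall>v. ROF_minimizer nu m lam f v \<longrightarrow> (AE x in nu. v x = ul x))) \<and>
           (ul \<in> L2 nu \<and> (\<lambda>x. lam * (ul x - f x)) \<in> one_laplacian nu m ul \<and>
            (\<forall>v\<in>L2 nu. (\<lambda>x. lam * (v x - f x)) \<in> one_laplacian nu m v \<longrightarrow>
               (AE x in nu. v x = ul x)))) \<and>
         (\<forall>u\<in>L2 nu. ROF_minimizer nu m lam f u \<longleftrightarrow>
           (\<exists>g\<in>Linf (kernel_prod nu m).
              antisymmetric (kernel_prod nu m) g \<and>
              Linf_norm (kernel_prod nu m) g \<le> 1 \<and>
              (AE x in nu. lam * (u x - f x) = m_div m g x) \<and>
              (AE (x, y) in kernel_prod nu m. g (x, y) \<in> msign (u y - u x))))"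
proof -
  interpret reversible_walk m nu
    by (rule reversible_walk.intro) fact+
  note f = \<open>f \<in> L2 nu\<close> and lam = \<open>lam > 0\<close>
  obtain ul g where ul: "ul \<in> L2 nu" and g: "g \<in> flows"
    and div: "\<And>x. lam * (ul x - f x) = m_div m g x"
    and sign: "AE p in K. g p \<in> msign (ul (snd p) - ul (fst p))"
    using solution_exists[OF f lam] by blast
  have vL2: "(\<lambda>x. lam * (u x - f x)) \<in> L2 nu" if "u \<in> L2 nu" for u
    by (intro L2_cmult L2_diff that f)
  have lap: "(\<lambda>x. lam * (ul x - f x)) \<in> one_laplacian nu m ul"
    by (rule flow_imp_one_laplacian[OF ul vL2[OF ul] g _ sign]) (simp add: div)
  note min = one_laplacian_imp_ROF_minimizer[OF f lam] and unique = ROF_minimizer_unique[OF f lam lap]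
  have "ROF_minimizer nu m lam f u \<longleftrightarrow>
      (\<exists>g\<in>Linf K. antisymmetric K g \<and> Linf_norm K g \<le> 1 \<and>
        (AE x in nu. lam * (u x - f x) = m_div m g x) \<and>
        (AE (x, y) in K. g (x, y) \<in> msign (u y - u x)))" (is "_ \<longleftrightarrow> ?flow") if u: "u \<in> L2 nu" for u
  proof
    assume "ROF_minimizer nu m lam f u"
    then have eq: "AE x in nu. u x = ul x" by (rule unique)
    have gm: "g \<in> borel_measurable K" by (rule flow_measurable_K[OF g])
    have norm: "Linf_norm K g \<le> 1"
      unfolding Linf_norm_def
      by (rule esssup_I) (use gm flowsD(2)[OF g] in auto)
    then have "Linf_norm K g < \<infinity>" by (rule le_less_trans) simp
    with gm have "g \<in> Linf K" by (simp add: Linf_def)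
    moreover have "antisymmetric K g"
      unfolding antisymmetric_def by (auto intro!: AE_I2 flowsD(3)[OF g])
    moreover have "AE x in nu. lam * (u x - f x) = m_div m g x"
      using eq by eventually_elim (simp add: div)
    moreover have "AE (x, y) in K. g (x, y) \<in> msign (u y - u x)"
      using AE_K_ends(1)[OF eq] AE_K_ends(2)[OF eq] sign
      by eventually_elim (simp add: case_prod_beta)
    ultimately show ?flow using norm by blast
  next
    assume ?flow
    then obtain g where g: "g \<in> Linf K" "antisymmetric K g" "Linf_norm K g \<le> 1"
      and div: "AE x in nu. lam * (u x - f x) = m_div m g x"
      and sign: "AE (x, y) in K. g (x, y) \<in> msign (u y - u x)" by blast
    obtain h where h: "h \<in> flows" and hg: "AE p in K. h p = g p"
      and hdiv: "AE x in nu. m_div m h x = m_div m g x"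
      using antisymmetric_representative[OF g] by blast
    show "ROF_minimizer nu m lam f u"
    proof (rule min, rule flow_imp_one_laplacian[OF u vL2[OF u] h])
      show "AE x in nu. lam * (u x - f x) = m_div m h x"
        using div hdiv by eventually_elim simp
      show "AE p in K. h p \<in> msign (u (snd p) - u (fst p))"
        using sign hg by eventually_elim (simp add: case_prod_beta)
    qed
  qed
  with ul lap min unique show ?thesis by blast
qed

end
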